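(* Let $t\in\mathbb{R}$ with $t<0$. Then every element $(a,b)\in\mathbb{H}_t^{\times}$ is invertible in $\mathbb{H}_t$, with inverse $$\left(\frac{\overline{a}}{|a|^{2}-t|b|^{2}},\;\frac{-b}{|a|^{2}-t|b|^{2}}\right)\in\mathbb{H}_t^{\times}.$$ That is, if $t<0$ then $\mathbb{H}_t$ is a noncommutative field.
   Context: For $t\in\mathbb{R}$, the $t$-scaled hypercomplex ring is $\mathbb{H}_t=(\mathbb{C}^2,+,\cdot_t)$, where $+$ is the usual vector addition and $(a_1,b_1)\cdot_t(a_2,b_2)=(a_1a_2+tb_1\overline{b_2},\;a_1b_2+b_1\overline{a_2})$, with unity $(1,0)$. Put $\mathbb{H}_t^{\times}=\mathbb{H}_t\setminus\{(0,0)\}$. An element $\xi\in\mathbb{H}_t$ is invertible if there is $\eta\in\mathbb{H}_t$ with $\xi\cdot_t\eta=(1,0)=\eta\cdot_t\xi$. An algebraic triple $(X,+,\cdot)$ is called a noncommutative field if (i) $(X,+)$ is an abelian group, (ii) $(X^{\times},\cdot)$, with $X^\times=X\setminus\{0\}$, is a non-abelian group, and (iii) $+$ and $\cdot$ are left-and-right distributive. *)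

theory Defs
  imports Complex_Main "HOL-Algebra.Ring" "HOL-Library.Product_Plus"
begin

definition hypercomplex_mult :: "real \<Rightarrow> complex \<times> complex \<Rightarrow> complex \<times> complex \<Rightarrow> complex \<times> complex"
  where "hypercomplex_mult t \<xi> \<eta> =
    (fst \<xi> * fst \<eta> + of_real t * snd \<xi> * cnj (snd \<eta>),
     fst \<xi> * snd \<eta> + snd \<xi> * cnj (fst \<eta>))"

text \<open>The \<open>t\<close>-scaled hypercomplex ring. Invertibility and inverses in it are the library's
  \<open>Units\<close> and \<open>m_inv\<close>, which are two-sided.\<close>

definition hypercomplex_ring :: "real \<Rightarrow> (complex \<times> complex) ring"
  where "hypercomplex_ring t =
    \<lparr>carrier = UNIV, mult = hypercomplex_mult t, one = (1, 0), zero = (0, 0), add = (+)\<rparr>"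

definition nonzero_elems :: "('a, 'm) ring_scheme \<Rightarrow> 'a set"
  where "nonzero_elems R = carrier R - {\<zero>\<^bsub>R\<^esub>}"

definition nonzero_monoid :: "('a, 'm) ring_scheme \<Rightarrow> 'a monoid"
  where "nonzero_monoid R = \<lparr>carrier = nonzero_elems R, mult = mult R, one = one R\<rparr>"

text \<open>The library's \<open>Ring.field\<close> is commutative, so the notion is spelled out here. The group
  predicate includes closure of the nonzero elements under multiplication.\<close>

definition noncommutative_field :: "('a, 'm) ring_scheme \<Rightarrow> bool"
  where "noncommutative_field R \<longleftrightarrow>
    abelian_group R \<and>
    group (nonzero_monoid R) \<and> \<not> comm_group (nonzero_monoid R) \<and>
    (\<forall>x \<in> carrier R. \<forall>y \<in> carrier R. \<forall>z \<in> carrier R.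
       x \<otimes>\<^bsub>R\<^esub> (y \<oplus>\<^bsub>R\<^esub> z) = x \<otimes>\<^bsub>R\<^esub> y \<oplus>\<^bsub>R\<^esub> x \<otimes>\<^bsub>R\<^esub> z \<and>
       (x \<oplus>\<^bsub>R\<^esub> y) \<otimes>\<^bsub>R\<^esub> z = x \<otimes>\<^bsub>R\<^esub> z \<oplus>\<^bsub>R\<^esub> y \<otimes>\<^bsub>R\<^esub> z)"

end

theory Submission imports Defs begin

text \<open>For every real \<open>t\<close> the structure \<open>hypercomplex_ring t\<close> is an associative ring with unity, since
  \<open>(a, b)\<close> multiplies like the \<open>2 \<times> 2\<close> complex matrix with rows \<open>(a, t b)\<close> and
  \<open>(cnj b, cnj a)\<close>. The adjugate of this matrix belongs to \<open>(cnj a, - b)\<close>, so both products of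
  \<open>(a, b)\<close> and \<open>(cnj a, - b)\<close> are the determinant \<open>\<bar>a\<bar>\<^sup>2 - t \<bar>b\<bar>\<^sup>2\<close>
  times the unity. The sign of \<open>t\<close> enters only here: for \<open>t < 0\<close> the determinant is a
  positive definite form in \<open>(a, b)\<close>, so it vanishes only at the origin, and dividing by it gives
  the inverse.

  Consequently the nonzero elements are exactly the units. The units of any monoid form a group,
  which yields closure under multiplication and associativity at once; it is not abelian because
  \<open>(\<i>, 0)\<close> and \<open>(0, 1)\<close> anticommute.\<close>

lemma noncommutative_field_if_Units_eq_nonzero:
  assumes "ring R" and units: "Units R = nonzero_elems R"
    and "x \<in> Units R" "y \<in> Units R" "x \<otimes>\<^bsub>R\<^esub> y \<noteq> y \<otimes>\<^bsub>R\<^esub> x"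
  shows "noncommutative_field R"
proof -
  interpret ring R by fact
  have eq: "nonzero_monoid R = units_of R"
    by (simp add: nonzero_monoid_def units_of_def units)
  have "group (nonzero_monoid R)"
    unfolding eq by (rule units_group)
  moreover have "\<not> comm_group (nonzero_monoid R)"
  proof
    assume "comm_group (nonzero_monoid R)"
    then interpret U: comm_group "units_of R"
      by (simp add: eq)
    from U.m_comm[of x y] assms(3-5) show False
      by (simp add: units_of_def)
  qed
  ultimately show ?thesis
    by (simp add: noncommutative_field_def abelian_group_axioms l_distr r_distr)
qed

lemma ring_hypercomplex_ring: "ring (hypercomplex_ring t)"
proof (rule ringI)
  show "abelian_group (hypercomplex_ring t)"
  proof (rule abelian_groupI)
    fix x assume "x \<in> carrier (hypercomplex_ring t)"
    show "\<exists>y \<in> carrier (hypercomplex_ring t).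
        y \<oplus>\<^bsub>hypercomplex_ring t\<^esub> x = \<zero>\<^bsub>hypercomplex_ring t\<^esub>"
      by (rule bexI[of _ "- x"]) (simp_all add: hypercomplex_ring_def zero_prod_def)
  qed (auto simp: hypercomplex_ring_def algebra_simps zero_prod_def)
  show "monoid (hypercomplex_ring t)"
    by (rule monoidI)
      (auto simp: hypercomplex_ring_def hypercomplex_mult_def algebra_simps)
qed (auto simp: hypercomplex_ring_def hypercomplex_mult_def algebra_simps)

lemma hypercomplex_norm_pos:
  assumes "t < 0" and "(a, b) \<noteq> (0, 0)"
  shows "(cmod a)\<^sup>2 - t * (cmod b)\<^sup>2 > 0"
proof (cases "b = 0")
  case True
  then show ?thesis using assms by simp
next
  case False
  then have "t * (cmod b)\<^sup>2 < 0"
    using \<open>t < 0\<close> by (simp add: mult_less_0_iff)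
  then show ?thesis
    using zero_le_power2[of "cmod a"] by linarith
qed

text \<open>The first component of each product is \<open>(a cnj a - t b cnj b) / n = 1\<close>. In the first product
  the conjugation also falls on the denominator, so both this and the cancellation in the second
  component depend on \<open>n\<close> being real.\<close>

lemma hypercomplex_mult_inverse:
  fixes t :: real and a b :: complex
  defines "n \<equiv> complex_of_real ((cmod a)\<^sup>2 - t * (cmod b)\<^sup>2)"
  assumes "n \<noteq> 0"
  shows "hypercomplex_mult t (a, b) (cnj a / n, - b / n) = (1, 0)"
    and "hypercomplex_mult t (cnj a / n, - b / n) (a, b) = (1, 0)"
proof -
  have n: "a * cnj a - of_real t * (b * cnj b) = n"
    unfolding n_def by (simp only: of_real_diff of_real_mult complex_norm_square)
  have cnj_n: "cnj n = n"
    by (simp add: n_def)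
  have "a * (cnj a / n) + of_real t * b * cnj (- b / n) =
      (a * cnj a - of_real t * (b * cnj b)) / n"
    by (simp add: cnj_n diff_divide_distrib)
  moreover have "cnj a / n * a + of_real t * (- b / n) * cnj b =
      (a * cnj a - of_real t * (b * cnj b)) / n"
    by (simp add: diff_divide_distrib mult_ac)
  ultimately show "hypercomplex_mult t (a, b) (cnj a / n, - b / n) = (1, 0)"
    and "hypercomplex_mult t (cnj a / n, - b / n) (a, b) = (1, 0)"
    using \<open>n \<noteq> 0\<close> by (simp_all add: hypercomplex_mult_def n cnj_n)
qed

theorem theorem11:
  fixes t :: real
  assumes "t < 0"
  shows "(\<forall>a b. (a, b) \<in> nonzero_elems (hypercomplex_ring t) \<longrightarrow>
            (a, b) \<in> Units (hypercomplex_ring t) \<and>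
            inv\<^bsub>hypercomplex_ring t\<^esub> (a, b) =
              (cnj a / complex_of_real ((cmod a)\<^sup>2 - t * (cmod b)\<^sup>2),
               - b / complex_of_real ((cmod a)\<^sup>2 - t * (cmod b)\<^sup>2)) \<and>
            (cnj a / complex_of_real ((cmod a)\<^sup>2 - t * (cmod b)\<^sup>2),
             - b / complex_of_real ((cmod a)\<^sup>2 - t * (cmod b)\<^sup>2))
              \<in> nonzero_elems (hypercomplex_ring t)) \<and>
         noncommutative_field (hypercomplex_ring t)"
proof -
  let ?R = "hypercomplex_ring t"
  interpret ring ?R by (rule ring_hypercomplex_ring)
  have nonzero_iff: "x \<in> nonzero_elems ?R \<longleftrightarrow> x \<noteq> (0, 0)" for x
    by (simp add: nonzero_elems_def hypercomplex_ring_def)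
  have inverse: "(a, b) \<in> Units ?R \<and>
      inv\<^bsub>?R\<^esub> (a, b) =
        (cnj a / complex_of_real ((cmod a)\<^sup>2 - t * (cmod b)\<^sup>2),
         - b / complex_of_real ((cmod a)\<^sup>2 - t * (cmod b)\<^sup>2)) \<and>
      (cnj a / complex_of_real ((cmod a)\<^sup>2 - t * (cmod b)\<^sup>2),
       - b / complex_of_real ((cmod a)\<^sup>2 - t * (cmod b)\<^sup>2)) \<in> nonzero_elems ?R"
    if ab: "(a, b) \<in> nonzero_elems ?R" for a b
  proof -
    define n where "n = complex_of_real ((cmod a)\<^sup>2 - t * (cmod b)\<^sup>2)"
    let ?y = "(cnj a / n, - b / n)"
    have "n \<noteq> 0"
      using hypercomplex_norm_pos[OF \<open>t < 0\<close>, of a b] ab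
      unfolding n_def nonzero_iff of_real_eq_0_iff by simp
    then have mult: "(a, b) \<otimes>\<^bsub>?R\<^esub> ?y = \<one>\<^bsub>?R\<^esub>" "?y \<otimes>\<^bsub>?R\<^esub> (a, b) = \<one>\<^bsub>?R\<^esub>"
      using hypercomplex_mult_inverse[where t = t and a = a and b = b, folded n_def]
      by (simp_all add: hypercomplex_ring_def)
    have carrier: "x \<in> carrier ?R" for x
      by (simp add: hypercomplex_ring_def)
    have "(a, b) \<in> Units ?R"
      unfolding Units_def using mult carrier by blast
    moreover have "inv\<^bsub>?R\<^esub> (a, b) = ?y"
      using inv_unique'[OF carrier carrier mult] by simp
    moreover have "?y \<in> nonzero_elems ?R"
      using ab \<open>n \<noteq> 0\<close> by (auto simp: nonzero_iff)
    ultimately show ?thesis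
      unfolding n_def by blast
  qed
  have "(0, 0) \<notin> Units ?R"
    by (auto simp: Units_def hypercomplex_ring_def hypercomplex_mult_def)
  then have units: "Units ?R = nonzero_elems ?R"
    using inverse nonzero_iff by auto
  have "noncommutative_field ?R"
  proof (rule noncommutative_field_if_Units_eq_nonzero[OF ring_axioms units])
    show "(\<i>, 0) \<in> Units ?R" "(0, 1) \<in> Units ?R"
      by (simp_all add: units nonzero_iff)
    show "(\<i>, 0) \<otimes>\<^bsub>?R\<^esub> (0, 1) \<noteq> (0, 1) \<otimes>\<^bsub>?R\<^esub> (\<i>, 0)"
      by (simp add: hypercomplex_ring_def hypercomplex_mult_def complex_eq_iff)
  qed
  with inverse show ?thesis
    by blast
qed

end
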